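(* Let $\mathcal{D}=(D,<,\approx)$, where $D$ is an infinite set, $<$ is a strict total order on $D$, and $\approx$ is equality. Then the satisfiability problem for $\mathrm{CLRV}^{\mathrm{XF},\mathrm{XF}^{-1},\mathrm{int}}(\mathcal{D})$ is undecidable.
   Context: The variable set is $V=V_{\mathrm{local}}\uplus V_{\mathrm{remote}}$, a disjoint union of local and remote variables. $\mathrm{CLRV}^{\mathrm{XF},\mathrm{XF}^{-1},\mathrm{int}}(\mathcal{D})$ formulas are given by the grammar $\phi ::= x_{loc}\approx \mathbf{X}^i y_{loc} \mid x_{loc}< \mathbf{X}^i y_{loc} \mid x_{rem}\approx \mathbf{X}^i y_{rem} \mid x_{rem}\approx \mathbf{XF}\, y_{rem} \mid x_{rem}\approx \mathbf{XF}^{-1} y_{rem} \mid x_{loc}\approx y_{rem} \mid \phi\wedge\phi \mid \neg\phi \mid \mathbf{X}\phi \mid \phi\mathbf{U}\phi \mid \mathbf{X}^{-1}\phi \mid \phi\mathbf{S}\phi$. Here $x_{loc},y_{loc}\in V_{\mathrm{local}}$, $x_{rem},y_{rem}\in V_{\mathrm{remote}}$ and $i\in\mathbb{N}$. A model is an infinite sequence $\sigma$ of maps $V\to D$, with the following semantics. - $\sigma,i\models x\approx\mathbf{X}^jy$ iff $\sigma(i)(x)=\sigma(i+j)(y)$. - $\sigma,i\models x<\mathbf{X}^jy$ iff $\sigma(i)(x)<\sigma(i+j)(y)$. - $\sigma,i\models x\approx\mathbf{XF}y$ iff there is $j>i$ with $\sigma(i)(x)=\sigma(j)(y)$. - $\sigma,i\models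 x\approx\mathbf{XF}^{-1}y$ iff there is $0\le j<i$ with $\sigma(i)(x)=\sigma(j)(y)$. - $\sigma,i\models x_{loc}\approx y_{rem}$ iff $\sigma(i)(x_{loc})=\sigma(i)(y_{rem})$; this is an equality between a local and a remote variable at the same position. - Boolean connectives and $\mathbf{X},\mathbf{U}$ are as in LTL. - $\sigma,i\models\mathbf{X}^{-1}\phi$ iff $i\ge1$ and $\sigma,i-1\models\phi$. - $\sigma,i\models\phi\mathbf{S}\phi'$ iff there is $j\le i$ with $\sigma,j\models\phi'$ and $\sigma,k\models\phi$ for all $j<k\le i$. The satisfiability problem asks, given a formula $\phi$, whether some model $\sigma$ satisfies $\sigma,0\models\phi$. *)

theory Defs
  imports Main "HOL-Library.Nat_Bijection"
begin

datatype recf =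
    Zero
  | Succ
  | Proj nat
  | Comp recf "recf list"
  | PrimRec recf recf
  | Mu recf

inductive reval :: "recf \<Rightarrow> nat list \<Rightarrow> nat \<Rightarrow> bool" where
  zero: "reval Zero xs 0"
| succ: "reval Succ (x # xs) (Suc x)"
| proj: "i < length xs \<Longrightarrow> reval (Proj i) xs (xs ! i)"
| comp: "length ys = length gs \<Longrightarrow> (\<forall>k < length gs. reval (gs ! k) xs (ys ! k))
          \<Longrightarrow> reval f ys z \<Longrightarrow> reval (Comp f gs) xs z"
| pr0: "reval f xs y \<Longrightarrow> reval (PrimRec f g) (0 # xs) y"
| prS: "reval (PrimRec f g) (n # xs) y \<Longrightarrow> reval g (n # y # xs) z
          \<Longrightarrow> reval (PrimRec f g) (Suc n # xs) z"
| mu: "reval f (n # xs) 0 \<Longrightarrow> (\<forall>m < n. \<exists>y. reval f (m # xs) (Suc y))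
          \<Longrightarrow> reval (Mu f) xs n"

definition decidable_via :: "('a \<Rightarrow> nat) \<Rightarrow> ('a \<Rightarrow> bool) \<Rightarrow> bool" where
  "decidable_via enc P \<longleftrightarrow>
     (\<exists>f. \<forall>x. \<forall>y. reval f [enc x] y \<longleftrightarrow> y = (if P x then 1 else 0))"

text \<open>Variables: V = V_local (Loc n) disjoint union V_remote (Rem n).\<close>
datatype var = Loc nat | Rem nat

datatype clrv =
    LocEqX nat nat nat
  | LocLtX nat nat nat
  | RemEqX nat nat nat
  | RemEqXF nat nat
  | RemEqXFinv nat nat
  | LocEqRem nat nat
  | And clrv clrv
  | Not clrv
  | Next clrv
  | Until clrv clrv
  | Prev clrv
  | Since clrv clrv

fun holds :: "(nat \<Rightarrow> var \<Rightarrow> 'd::linorder) \<Rightarrow> nat \<Rightarrow> clrv \<Rightarrow> bool" where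
  "holds \<sigma> i (LocEqX x k y) \<longleftrightarrow> \<sigma> i (Loc x) = \<sigma> (i + k) (Loc y)"
| "holds \<sigma> i (LocLtX x k y) \<longleftrightarrow> \<sigma> i (Loc x) < \<sigma> (i + k) (Loc y)"
| "holds \<sigma> i (RemEqX x k y) \<longleftrightarrow> \<sigma> i (Rem x) = \<sigma> (i + k) (Rem y)"
| "holds \<sigma> i (RemEqXF x y) \<longleftrightarrow> (\<exists>j > i. \<sigma> i (Rem x) = \<sigma> j (Rem y))"
| "holds \<sigma> i (RemEqXFinv x y) \<longleftrightarrow> (\<exists>j < i. \<sigma> i (Rem x) = \<sigma> j (Rem y))"
| "holds \<sigma> i (LocEqRem x y) \<longleftrightarrow> \<sigma> i (Loc x) = \<sigma> i (Rem y)"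
| "holds \<sigma> i (And \<phi> \<psi>) \<longleftrightarrow> holds \<sigma> i \<phi> \<and> holds \<sigma> i \<psi>"
| "holds \<sigma> i (Not \<phi>) \<longleftrightarrow> \<not> holds \<sigma> i \<phi>"
| "holds \<sigma> i (Next \<phi>) \<longleftrightarrow> holds \<sigma> (Suc i) \<phi>"
| "holds \<sigma> i (Until \<phi> \<psi>) \<longleftrightarrow>
     (\<exists>j \<ge> i. holds \<sigma> j \<psi> \<and> (\<forall>k. i \<le> k \<and> k < j \<longrightarrow> holds \<sigma> k \<phi>))"
| "holds \<sigma> i (Prev \<phi>) \<longleftrightarrow> (i \<ge> 1 \<and> holds \<sigma> (i - 1) \<phi>)"
| "holds \<sigma> i (Since \<phi> \<psi>) \<longleftrightarrow>
     (\<exists>j \<le> i. holds \<sigma> j \<psi> \<and> (\<forall>k. j < k \<and> k \<le> i \<longrightarrow> holds \<sigma> k \<phi>))"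

definition satisfiable :: "'d::linorder itself \<Rightarrow> clrv \<Rightarrow> bool" where
  "satisfiable _ \<phi> \<longleftrightarrow> (\<exists>\<sigma> :: nat \<Rightarrow> var \<Rightarrow> 'd. holds \<sigma> 0 \<phi>)"

definition tag :: "nat \<Rightarrow> nat \<Rightarrow> nat" where
  "tag c n = prod_encode (c, n)"

fun encode :: "clrv \<Rightarrow> nat" where
  "encode (LocEqX x k y) = tag 0 (prod_encode (x, prod_encode (k, y)))"
| "encode (LocLtX x k y) = tag 1 (prod_encode (x, prod_encode (k, y)))"
| "encode (RemEqX x k y) = tag 2 (prod_encode (x, prod_encode (k, y)))"
| "encode (RemEqXF x y) = tag 3 (prod_encode (x, y))"
| "encode (RemEqXFinv x y) = tag 4 (prod_encode (x, y))"
| "encode (LocEqRem x y) = tag 5 (prod_encode (x, y))"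
| "encode (And \<phi> \<psi>) = tag 6 (prod_encode (encode \<phi>, encode \<psi>))"
| "encode (Not \<phi>) = tag 7 (encode \<phi>)"
| "encode (Next \<phi>) = tag 8 (encode \<phi>)"
| "encode (Until \<phi> \<psi>) = tag 9 (prod_encode (encode \<phi>, encode \<psi>))"
| "encode (Prev \<phi>) = tag 10 (encode \<phi>)"
| "encode (Since \<phi> \<psi>) = tag 11 (prod_encode (encode \<phi>, encode \<psi>))"

end

theory Submission
  imports Defs
begin

text \<open>
  A counter is represented by two nondecreasing variables \<open>a\<close> and \<open>b\<close>: its value is the number of
  values of \<open>a\<close> so far that exceed the current value of \<open>b\<close>. An increment raises \<open>a\<close>, a decrement
  raises \<open>b\<close>, and the zero test is the local test \<open>a \<approx> b\<close>. Remote copies of \<open>a\<close> and \<open>b\<close> with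
  \<open>XF\<close> and \<open>XF\<^sup>-\<^sup>1\<close> ensure that both run through the same values, so that a raise of \<open>b\<close> skips none.
  Since a terminating run uses only finitely many values, finite chains in \<open>D\<close> suffice.

  Suppose \<open>f\<close> decides satisfiability. The input \<open>n\<close> of a machine is imposed by one further atom
  \<open>x \<approx> X\<^sup>n y\<close>, so adding it to a formula is computable on codes. Take the machine that on input
  \<open>n\<close> applies \<open>f\<close> to the conjunction of the formula with code \<open>n\<close> and the input atom for \<open>n\<close>.
  That it runs from the given input and ends with result \<open>0\<close> is expressed by a formula \<open>\<psi>\<close>.
  For \<open>n\<close> the code of \<open>\<psi>\<close> the conjunction is satisfiable iff \<open>f\<close> rejects it.
\<close>

section \<open>Programs over registers\<close>

datatype cmd = Inc nat | Dec nat | Seq cmd cmd | Loop nat cmd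

text \<open>\<open>Loop\<close> takes one off its register before each round, so that its test and
  decrement become a single \<open>DJZ\<close>. A diverging program simply has no
  derivation.\<close>

inductive exec :: "cmd \<Rightarrow> (nat \<Rightarrow> nat) \<Rightarrow> (nat \<Rightarrow> nat) \<Rightarrow> bool" where
  inc: "exec (Inc r) s (s(r := Suc (s r)))"
| dec: "exec (Dec r) s (s(r := s r - 1))"
| seq: "exec c s t \<Longrightarrow> exec d t u \<Longrightarrow> exec (Seq c d) s u"
| loop0: "s r = 0 \<Longrightarrow> exec (Loop r c) s s"
| loopS: "s r \<noteq> 0 \<Longrightarrow> exec c (s(r := s r - 1)) t \<Longrightarrow> exec (Loop r c) t u \<Longrightarrow> exec (Loop r c) s u"

lemma exec_eq: "exec c s t \<Longrightarrow> t = t' \<Longrightarrow> exec c s t'"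
  by simp

lemma exec_dec0: "s r = 0 \<Longrightarrow> exec (Dec r) s s"
  by (rule exec_eq[OF exec.dec]) auto

text \<open>Each round lowers \<open>r\<close> twice, once by the loop and once by its body, hence
  the strong induction. From value 1 the second decrement is truncated.\<close>

lemma exec_clear: "exec (Loop r (Dec r)) s (s(r := 0))"
proof (induction "s r" arbitrary: s rule: less_induct)
  case less
  show ?case
  proof (cases "s r = 0")
    case True
    then show ?thesis
      by (intro exec_eq[OF exec.loop0]) (auto simp: fun_eq_iff)
  next
    case False
    let ?t = "s(r := s r - 1 - 1)"
    have "exec (Dec r) (s(r := s r - 1)) ?t"
      by (rule exec_eq[OF exec.dec]) auto
    moreover have "exec (Loop r (Dec r)) ?t (s(r := 0))"
      by (rule exec_eq[OF less]) (use False in auto)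
    ultimately show ?thesis
      using False exec.loopS by blast
  qed
qed

lemma exec_move:
  assumes "r \<noteq> d"
  shows "exec (Loop r (Inc d)) s (s(r := 0, d := s d + s r))"
proof (induction "s r" arbitrary: s)
  case 0
  then show ?case
    by (intro exec_eq[OF exec.loop0]) (auto simp: fun_eq_iff)
next
  case (Suc k)
  let ?t = "s(r := k, d := Suc (s d))"
  have "exec (Inc d) (s(r := s r - 1)) ?t"
    by (rule exec_eq[OF exec.inc]) (use assms Suc(2)[symmetric] in auto)
  moreover have "exec (Loop r (Inc d)) ?t (s(r := 0, d := s d + s r))"
    by (rule exec_eq[OF Suc(1)]) (use assms Suc(2) in auto)
  ultimately show ?case
    using Suc(2) exec.loopS by (metis nat.simps(3))
qed

text \<open>Reading a register by a loop destroys it, so the scratch register \<open>t\<close> keeps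
  the value from which \<open>r\<close> is restored.\<close>

definition copy :: "nat \<Rightarrow> nat \<Rightarrow> nat \<Rightarrow> cmd" where
  "copy r d t = Seq (Loop r (Seq (Inc d) (Inc t))) (Loop t (Inc r))"

lemma exec_copy:
  assumes "r \<noteq> d" "r \<noteq> t" "d \<noteq> t" "s t = 0"
  shows "exec (copy r d t) s (s(d := s d + s r))"
proof -
  have 1: "exec (Loop r (Seq (Inc d) (Inc t))) s (s(r := 0, d := s d + s r, t := s t + s r))" for s
  proof (induction "s r" arbitrary: s)
    case 0
    then show ?case
      by (intro exec_eq[OF exec.loop0]) (auto simp: fun_eq_iff)
  next
    case (Suc k)
    let ?t = "s(r := k, d := Suc (s d), t := Suc (s t))"
    have "exec (Seq (Inc d) (Inc t)) (s(r := s r - 1)) ?t"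
      by (rule exec_eq[OF exec.seq[OF exec.inc exec.inc]]) (use assms Suc(2)[symmetric] in auto)
    moreover have "exec (Loop r (Seq (Inc d) (Inc t))) ?t (s(r := 0, d := s d + s r, t := s t + s r))"
      by (rule exec_eq[OF Suc(1)]) (use assms Suc(2) in auto)
    ultimately show ?case
      using Suc(2) exec.loopS by (metis nat.simps(3))
  qed
  show ?thesis
    unfolding copy_def
    by (rule exec_eq[OF exec.seq[OF 1 exec_move]]) (use assms in auto)
qed

text \<open>There is no skip command. \<open>Dec\<close> on a register holding zero takes its place,
  here and in \<open>compile\<close> and \<open>compiles\<close>.\<close>

fun clears :: "nat \<Rightarrow> nat \<Rightarrow> cmd" where
  "clears d 0 = Dec d"
| "clears d (Suc k) = Seq (Loop d (Dec d)) (clears (Suc d) k)"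

lemma exec_clears:
  "s (d + k) = 0 \<Longrightarrow> exec (clears d k) s (\<lambda>r. if d \<le> r \<and> r < d + k then 0 else s r)"
proof (induction k arbitrary: d s)
  case 0
  then have "exec (Dec d) s s"
    by (simp add: exec_dec0)
  then show ?case
    unfolding clears.simps by (rule exec_eq) auto
next
  case (Suc k)
  have "exec (clears (Suc d) k) (s(d := 0)) (\<lambda>r. if d \<le> r \<and> r < d + Suc k then 0 else s r)"
    by (rule exec_eq[OF Suc.IH]) (use Suc.prems in auto)
  then show ?case
    using exec.seq[OF exec_clear] by simp
qed

section \<open>Compiling recursive functions\<close>

text \<open>The program adds the value of the function at the registers \<open>args\<close> to register \<open>out\<close>.
  Registers from \<open>n\<close> on are scratch; they are expected to be zero and left zero.\<close>

fun compile :: "recf \<Rightarrow> nat list \<Rightarrow> nat \<Rightarrow> nat \<Rightarrow> cmd"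
  and compiles :: "recf list \<Rightarrow> nat list \<Rightarrow> nat \<Rightarrow> nat \<Rightarrow> cmd" where
  "compile Zero args out n = Dec n"
| "compile Succ args out n = Seq (copy (args ! 0) out n) (Inc out)"
| "compile (Proj i) args out n = copy (args ! i) out n"
| "compile (Comp f gs) args out n =
     (let k = length gs in
      Seq (compiles gs args n (n + k))
        (Seq (compile f [n..<n + k] out (n + k)) (clears n k)))"
| "compile (PrimRec f g) args out n =
     Seq (copy (args ! 0) n (n + 1))
      (Seq (compile f (tl args) (n + 2) (n + 4))
        (Seq (Loop n
               (Seq (compile g ((n + 1) # (n + 2) # tl args) (n + 3) (n + 4))
                 (Seq (Loop (n + 2) (Dec (n + 2)))
                   (Seq (Loop (n + 3) (Inc (n + 2))) (Inc (n + 1))))))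
          (Seq (Loop (n + 2) (Inc out)) (Loop (n + 1) (Dec (n + 1))))))"
| "compile (Mu f) args out n =
     Seq (compile f (n # args) (n + 1) (n + 2))
      (Seq (Loop (n + 1)
             (Seq (Loop (n + 1) (Dec (n + 1)))
               (Seq (Inc n) (compile f (n # args) (n + 1) (n + 2)))))
        (Loop n (Inc out)))"
| "compiles [] args d n = Dec n"
| "compiles (g # gs) args d n = Seq (compile g args d n) (compiles gs args (Suc d) n)"

text \<open>Partial correctness in the sense needed for partial functions: where \<open>f\<close> is
  undefined, nothing is claimed about the program.\<close>

definition computes :: "recf \<Rightarrow> bool" where
  "computes f \<longleftrightarrow> (\<forall>xs y args out n s. reval f xs y \<longrightarrow> map s args = xs \<longrightarrow>
     (\<forall>r\<in>set args. r < n) \<longrightarrow> out < n \<longrightarrow> out \<notin> set args \<longrightarrow> (\<forall>r\<ge>n. s r = 0) \<longrightarrow>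
     exec (compile f args out n) s (s(out := s out + y)))"

lemma computesD:
  assumes "computes f" "reval f (map s args) y" "\<forall>r\<in>set args. r < n" "out < n"
    "out \<notin> set args" "\<forall>r\<ge>n. s r = 0" "t = s(out := s out + y)"
  shows "exec (compile f args out n) s t"
  using assms unfolding computes_def by blast

inductive_cases reval_ZeroE: "reval Zero xs y"
inductive_cases reval_SuccE: "reval Succ xs y"
inductive_cases reval_ProjE: "reval (Proj i) xs y"
inductive_cases reval_CompE: "reval (Comp f gs) xs y"
inductive_cases reval_PrimRecE: "reval (PrimRec f g) xs y"
inductive_cases reval_MuE: "reval (Mu f) xs y"

text \<open>The results are stored from \<open>d\<close> on, above every argument register, so each
  later function still sees the original arguments.\<close>

lemma exec_compiles:
  assumes "\<forall>g\<in>set gs. computes g" "length ys = length gs"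
    "\<forall>k<length gs. reval (gs ! k) (map s args) (ys ! k)"
    "\<forall>r\<in>set args. r < d" "d + length gs \<le> n" "\<forall>r\<ge>n. s r = 0"
  shows "exec (compiles gs args d n) s
    (\<lambda>r. if d \<le> r \<and> r < d + length gs then s r + ys ! (r - d) else s r)"
  using assms
proof (induction gs arbitrary: ys d s)
  case Nil
  then show ?case
    by (auto intro!: exec_eq[OF exec_dec0])
next
  case (Cons g gs)
  obtain y zs where ys: "ys = y # zs" and len: "length zs = length gs"
    using Cons.prems(2) by (cases ys) auto
  let ?t = "s(d := s d + y)"
  have args: "map ?t args = map s args"
    using Cons.prems(4) by auto
  have 1: "exec (compile g args d n) s ?t"
    by (rule computesD) (use Cons.prems ys in \<open>auto dest: spec[of _ 0]\<close>)
  have "exec (compiles gs args (Suc d) n) ?t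
    (\<lambda>r. if Suc d \<le> r \<and> r < Suc d + length gs then ?t r + zs ! (r - Suc d) else ?t r)"
  proof (rule Cons.IH)
    show "\<forall>k<length gs. reval (gs ! k) (map ?t args) (zs ! k)"
      unfolding args using Cons.prems(3) ys by auto
  qed (use Cons.prems len in auto)
  then have "exec (compiles gs args (Suc d) n) ?t
    (\<lambda>r. if d \<le> r \<and> r < d + length (g # gs) then s r + ys ! (r - d) else s r)"
    by (rule exec_eq) (auto simp: ys fun_eq_iff nth_Cons' Suc_diff_Suc)
  with 1 show ?case
    by (auto intro: exec.seq)
qed

lemma computes_Comp:
  assumes "computes f" "\<forall>g\<in>set gs. computes g"
  shows "computes (Comp f gs)"
  unfolding computes_def
proof (intro allI impI)
  fix xs y args and out n :: nat and s :: "nat \<Rightarrow> nat"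
  assume ev: "reval (Comp f gs) xs y" and xs: "map s args = xs"
    and args: "\<forall>r\<in>set args. r < n" and out: "out < n" "out \<notin> set args"
    and s: "\<forall>r\<ge>n. s r = 0"
  from ev obtain ys where ys: "length ys = length gs"
    "\<forall>k<length gs. reval (gs ! k) xs (ys ! k)" "reval f ys y"
    by (auto elim: reval_CompE)
  let ?k = "length gs"
  let ?t = "\<lambda>r. if n \<le> r \<and> r < n + ?k then s r + ys ! (r - n) else s r"
  let ?u = "?t(out := ?t out + y)"
  have 1: "exec (compiles gs args n (n + ?k)) s ?t"
    by (rule exec_compiles) (use assms ys xs args s in auto)
  have t: "map ?t [n..<n + ?k] = ys"
    by (rule nth_equalityI) (use s ys in auto)
  have 2: "exec (compile f [n..<n + ?k] out (n + ?k)) ?t ?u"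
    by (rule computesD) (use assms t ys out s in auto)
  have 3: "exec (clears n ?k) ?u (s(out := s out + y))"
    by (rule exec_eq[OF exec_clears]) (use out s in \<open>auto simp: fun_eq_iff\<close>)
  show "exec (compile (Comp f gs) args out n) s (s(out := s out + y))"
    using 1 2 3 by (auto simp: Let_def intro: exec.seq)
qed

text \<open>Unrolls the recursion into the sequence \<open>a\<close> of intermediate values, which
  the loop of the compiled program runs through.\<close>

lemma reval_PrimRecD:
  assumes "reval (PrimRec f g) (k # xs) y"
  shows "\<exists>a. reval f xs (a 0) \<and> (\<forall>i<k. reval g (i # a i # xs) (a (Suc i))) \<and> a k = y"
  using assms
proof (induction k arbitrary: y)
  case 0
  then show ?case
    by (auto elim: reval_PrimRecE intro: exI[of _ "\<lambda>_. y"])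
next
  case (Suc k)
  then obtain z where z: "reval (PrimRec f g) (k # xs) z" "reval g (k # z # xs) y"
    by (auto elim: reval_PrimRecE)
  then obtain a where a: "reval f xs (a 0)" "\<forall>i<k. reval g (i # a i # xs) (a (Suc i))" "a k = z"
    using Suc.IH by blast
  then show ?case
    using z by (intro exI[of _ "a(Suc k := y)"]) (auto simp: less_Suc_eq)
qed

text \<open>Register \<open>n\<close> holds the remaining rounds, \<open>n + 1\<close> the recursion
  index, \<open>n + 2\<close> the current value and \<open>n + 3\<close> the next value before it is
  moved down.\<close>

lemma computes_PrimRec:
  assumes "computes f" "computes g"
  shows "computes (PrimRec f g)"
  unfolding computes_def
proof (intro allI impI)
  fix xs y args and out n :: nat and s :: "nat \<Rightarrow> nat"
  assume ev: "reval (PrimRec f g) xs y" and xs: "map s args = xs"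
    and args: "\<forall>r\<in>set args. r < n" and out: "out < n" "out \<notin> set args"
    and s: "\<forall>r\<ge>n. s r = 0"
  obtain k zs where kz: "xs = k # zs"
    using ev by (auto elim: reval_PrimRecE)
  then obtain r rs where rs: "args = r # rs" and r: "s r = k" and zs: "map s rs = zs"
    using xs by auto
  obtain a where a0: "reval f zs (a 0)" and aS: "\<And>i. i < k \<Longrightarrow> reval g (i # a i # zs) (a (Suc i))"
    and ak: "a k = y"
    using reval_PrimRecD ev kz by blast
  let ?body = "Seq (compile g ((n + 1) # (n + 2) # rs) (n + 3) (n + 4))
                 (Seq (Loop (n + 2) (Dec (n + 2)))
                   (Seq (Loop (n + 3) (Inc (n + 2))) (Inc (n + 1))))"
  \<comment> \<open>The state with \<open>j\<close> rounds to go; the induction on \<open>j\<close>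
    below thus runs backwards along the recursion.\<close>
  let ?st = "\<lambda>j. s(n := j, n + 1 := k - j, n + 2 := a (k - j))"
  have upd: "map (s(n := p, n + 1 := q, n + 2 := w)) rs = zs" for p q w
    unfolding zs[symmetric] by (rule map_cong) (use args rs in auto)
  have 1: "exec (copy (args ! 0) n (n + 1)) s (s(n := k))"
    by (rule exec_eq[OF exec_copy]) (use args rs r s in auto)
  have 2: "exec (compile f rs (n + 2) (n + 4)) (s(n := k)) (?st k)"
    by (rule computesD[OF assms(1)]) (use zs a0 args rs s upd[of k 0 0] in \<open>auto simp: fun_eq_iff\<close>)
  have 3: "exec (Loop n ?body) (?st j) (?st 0)" if "j \<le> k" for j
    using that
  proof (induction j)
    case 0
    show ?case
      by (rule exec.loop0) auto
  next
    case (Suc j)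
    let ?i = "k - Suc j"
    let ?s1 = "s(n := j, n + 1 := ?i, n + 2 := a ?i)"
    have i: "?i < k" "Suc ?i = k - j"
      using Suc.prems by auto
    have "exec (compile g ((n + 1) # (n + 2) # rs) (n + 3) (n + 4)) ?s1 (?s1(n + 3 := a (k - j)))"
    proof (rule computesD[OF assms(2)])
      show "reval g (map ?s1 ((n + 1) # (n + 2) # rs)) (a (k - j))"
        using aS[OF i(1)] upd[of j ?i "a ?i"] i by auto
    qed (use args rs s in auto)
    moreover have "exec (Loop (n + 2) (Dec (n + 2))) (?s1(n + 3 := a (k - j)))
        (?s1(n + 3 := a (k - j), n + 2 := 0))"
      by (rule exec_clear)
    moreover have "exec (Loop (n + 3) (Inc (n + 2))) (?s1(n + 3 := a (k - j), n + 2 := 0))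
        (?s1(n + 2 := a (k - j)))"
      by (rule exec_eq[OF exec_move]) (use s in \<open>auto simp: fun_eq_iff\<close>)
    moreover have "exec (Inc (n + 1)) (?s1(n + 2 := a (k - j))) (?st j)"
      by (rule exec_eq[OF exec.inc]) (use i in \<open>auto simp: fun_eq_iff\<close>)
    ultimately have body: "exec ?body ?s1 (?st j)"
      by (meson exec.seq)
    have s1: "(?st (Suc j))(n := ?st (Suc j) n - 1) = ?s1"
      by (auto simp: fun_eq_iff)
    show ?case
    proof (rule exec.loopS)
      show "exec ?body ((?st (Suc j))(n := ?st (Suc j) n - 1)) (?st j)"
        unfolding s1 by (rule body)
      show "exec (Loop n ?body) (?st j) (?st 0)"
        using Suc by (meson Suc_leD)
    qed auto
  qed
  have 4: "exec (Loop (n + 2) (Inc out)) (?st 0) (s(out := s out + y, n + 1 := k))"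
    by (rule exec_eq[OF exec_move]) (use out s ak in \<open>auto simp: fun_eq_iff\<close>)
  have 5: "exec (Loop (n + 1) (Dec (n + 1))) (s(out := s out + y, n + 1 := k)) (s(out := s out + y))"
    by (rule exec_eq[OF exec_clear]) (use out s in \<open>auto simp: fun_eq_iff\<close>)
  show "exec (compile (PrimRec f g) args out n) s (s(out := s out + y))"
    using 1 2 3[OF order_refl] 4 5 by (auto simp: rs intro!: exec.seq)
qed

text \<open>Register \<open>n\<close> holds the candidate and \<open>n + 1\<close> the value of
  \<open>f\<close> there. The loop ends when that value is zero; otherwise its remainder is cleared
  and the next candidate is tried.\<close>

lemma computes_Mu:
  assumes "computes f"
  shows "computes (Mu f)"
  unfolding computes_def
proof (intro allI impI)
  fix xs y args and out n :: nat and s :: "nat \<Rightarrow> nat"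
  assume ev: "reval (Mu f) xs y" and xs: "map s args = xs"
    and args: "\<forall>r\<in>set args. r < n" and out: "out < n" "out \<notin> set args"
    and s: "\<forall>r\<ge>n. s r = 0"
  from ev have "\<forall>m\<le>y. \<exists>z. reval f (m # xs) z \<and> (z = 0 \<longleftrightarrow> m = y)"
    by (auto elim!: reval_MuE simp: le_less)
  then obtain a where a: "\<And>m. m \<le> y \<Longrightarrow> reval f (m # xs) (a m)"
    and a0: "\<And>m. m \<le> y \<Longrightarrow> a m = 0 \<longleftrightarrow> m = y"
    by metis
  \<comment> \<open>Here \<open>j\<close> counts the candidates still to be passed before
    \<open>y\<close> is reached.\<close>
  let ?st = "\<lambda>j. s(n := y - j, n + 1 := a (y - j))"
  let ?f = "compile f (n # args) (n + 1) (n + 2)"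
  let ?body = "Seq (Loop (n + 1) (Dec (n + 1))) (Seq (Inc n) ?f)"
  have step: "exec ?f (s(n := y - j)) (?st j)" if "j \<le> y" for j
  proof (rule computesD[OF assms])
    have "map (s(n := y - j)) (n # args) = (y - j) # xs"
      using xs args by auto
    then show "reval f (map (s(n := y - j)) (n # args)) (a (y - j))"
      using a[of "y - j"] by simp
  qed (use args s in auto)
  have loop: "exec (Loop (n + 1) ?body) (?st j) (?st 0)" if "j \<le> y" for j
    using that
  proof (induction j)
    case 0
    show ?case
      by (rule exec.loop0) (use a0 in auto)
  next
    case (Suc j)
    let ?s1 = "(?st (Suc j))(n + 1 := ?st (Suc j) (n + 1) - 1)"
    have i: "Suc (y - Suc j) = y - j"
      using Suc.prems by auto
    have "exec (Loop (n + 1) (Dec (n + 1))) ?s1 (s(n := y - Suc j))"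
      by (rule exec_eq[OF exec_clear]) (use s in \<open>auto simp: fun_eq_iff\<close>)
    moreover have "exec (Inc n) (s(n := y - Suc j)) (s(n := y - j))"
      by (rule exec_eq[OF exec.inc]) (use i in \<open>auto simp: fun_eq_iff\<close>)
    ultimately have "exec ?body ?s1 (?st j)"
      using step[of j] Suc.prems by (meson exec.seq Suc_leD)
    moreover have "?st (Suc j) (n + 1) \<noteq> 0"
      using a0[of "y - Suc j"] Suc.prems by auto
    ultimately show ?case
      using Suc exec.loopS by (meson Suc_leD)
  qed
  have start: "exec ?f s (?st y)"
  proof -
    have "s(n := y - y) = s"
      using s by (auto simp: fun_eq_iff)
    then show ?thesis
      using step[of y] by simp
  qed
  have fin: "exec (Loop n (Inc out)) (?st 0) (s(out := s out + y))"
    by (rule exec_eq[OF exec_move]) (use out s a0 in \<open>auto simp: fun_eq_iff\<close>)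
  show "exec (compile (Mu f) args out n) s (s(out := s out + y))"
    using start loop[OF order_refl] fin by (auto intro!: exec.seq)
qed

lemma computes: "computes f"
proof (induction f)
  case Zero
  show ?case
    unfolding computes_def by (auto elim!: reval_ZeroE intro!: exec_dec0)
next
  case Succ
  show ?case
    unfolding computes_def
  proof (intro allI impI)
    fix xs y args and out n :: nat and s :: "nat \<Rightarrow> nat"
    assume ev: "reval Succ xs y" and xs: "map s args = xs"
      and args: "\<forall>r\<in>set args. r < n" and out: "out < n" "out \<notin> set args"
      and s: "\<forall>r\<ge>n. s r = 0"
    then obtain r rs where "args = r # rs" "y = Suc (s r)"
      by (auto elim!: reval_SuccE)
    moreover have "exec (Inc out) (s(out := s out + s r)) (s(out := s out + Suc (s r)))" for r
      by (rule exec_eq[OF exec.inc]) auto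
    ultimately show "exec (compile Succ args out n) s (s(out := s out + y))"
      using args out s by (auto intro!: exec.seq exec_copy)
  qed
next
  case (Proj i)
  show ?case
    unfolding computes_def
  proof (intro allI impI)
    fix xs y args and out n :: nat and s :: "nat \<Rightarrow> nat"
    assume ev: "reval (Proj i) xs y" and xs: "map s args = xs"
      and args: "\<forall>r\<in>set args. r < n" and out: "out < n" "out \<notin> set args"
      and s: "\<forall>r\<ge>n. s r = 0"
    then have "i < length args" "y = s (args ! i)"
      by (auto elim!: reval_ProjE)
    then show "exec (compile (Proj i) args out n) s (s(out := s out + y))"
      using args out s nth_mem[of i args] by (auto intro!: exec_copy)
  qed
next
  case (Comp f gs)
  then show ?case
    by (simp add: computes_Comp)
next
  case (PrimRec f g)
  then show ?case
    by (simp add: computes_PrimRec)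
next
  case (Mu f)
  then show ?case
    by (simp add: computes_Mu)
qed

section \<open>Labelled counter machines\<close>

text \<open>\<open>DJZ r l e\<close> jumps to \<open>e\<close> if register \<open>r\<close> is zero and otherwise decrements it and jumps to \<open>l\<close>.\<close>

datatype instr = INC nat nat | DJZ nat nat nat

inductive step :: "(nat \<times> instr) list \<Rightarrow> nat \<times> (nat \<Rightarrow> nat) \<Rightarrow> nat \<times> (nat \<Rightarrow> nat) \<Rightarrow> bool"
  for T where
  INC: "(l, INC r e) \<in> set T \<Longrightarrow> step T (l, s) (e, s(r := Suc (s r)))"
| DJZ_0: "(l, DJZ r l' e) \<in> set T \<Longrightarrow> s r = 0 \<Longrightarrow> step T (l, s) (e, s)"
| DJZ_S: "(l, DJZ r l' e) \<in> set T \<Longrightarrow> s r \<noteq> 0 \<Longrightarrow> step T (l, s) (l', s(r := s r - 1))"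

fun len :: "cmd \<Rightarrow> nat" where
  "len (Inc r) = 1"
| "len (Dec r) = 1"
| "len (Seq c d) = len c + len d"
| "len (Loop r c) = Suc (len c)"

fun code :: "nat \<Rightarrow> nat \<Rightarrow> cmd \<Rightarrow> (nat \<times> instr) list" where
  "code l e (Inc r) = [(l, INC r e)]"
| "code l e (Dec r) = [(l, DJZ r e e)]"
| "code l e (Seq c d) = code l (l + len c) c @ code (l + len c) e d"
| "code l e (Loop r c) = (l, DJZ r (Suc l) e) # code (Suc l) l c"

text \<open>Consecutive labels make the instruction at a label unique. Started at 1, the code also
  leaves label 0 and the exit label \<open>1 + len c\<close> without instruction.\<close>

lemma map_fst_code: "map fst (code l e c) = [l..<l + len c]"
proof (induction c arbitrary: l e)
  case (Seq c d)
  then show ?case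
    by (metis code.simps(3) len.simps(3) le_add1 add.assoc map_append upt_add_eq_append)
next
  case (Loop r c)
  then show ?case
    by (simp add: upt_conv_Cons)
qed auto

text \<open>Only inclusion in \<open>T\<close> is assumed, so the induction applies to the blocks of
  a larger program. The body of a loop exits to the label of its test.\<close>

lemma exec_steps:
  "exec c s t \<Longrightarrow> set (code l e c) \<subseteq> set T \<Longrightarrow> (step T)\<^sup>*\<^sup>* (l, s) (e, t)"
proof (induction arbitrary: l e rule: exec.induct)
  case (inc r s)
  then show ?case
    by (intro r_into_rtranclp step.INC) simp
next
  case (dec r s)
  then have T: "(l, DJZ r e e) \<in> set T"
    by simp
  show ?case
  proof (cases "s r = 0")
    case True
    then show ?thesis
      using step.DJZ_0[of l r e e T s] T by (simp add: fun_upd_idem r_into_rtranclp)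
  next
    case False
    then show ?thesis
      using step.DJZ_S[of l r e e T s] T by (simp add: r_into_rtranclp del: fun_upd_apply)
  qed
next
  case (seq c s t d u)
  have "(step T)\<^sup>*\<^sup>* (l, s) (l + len c, t)"
    by (rule seq.IH(1)) (use seq.prems in simp)
  also have "(step T)\<^sup>*\<^sup>* (l + len c, t) (e, u)"
    by (rule seq.IH(2)) (use seq.prems in simp)
  finally show ?case .
next
  case (loop0 s r c)
  then show ?case
    by (intro r_into_rtranclp step.DJZ_0[where r = r and l' = "Suc l"]) auto
next
  case (loopS s r c t u)
  have "step T (l, s) (Suc l, s(r := s r - 1))"
    by (rule step.DJZ_S) (use loopS in auto)
  also have "(step T)\<^sup>*\<^sup>* (Suc l, s(r := s r - 1)) (l, t)"
    by (rule loopS.IH(1)) (use loopS.prems in simp)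
  also have "(step T)\<^sup>*\<^sup>* (l, t) (e, u)"
    by (rule loopS.IH(2)) (use loopS.prems in simp)
  finally show ?case .
qed

section \<open>Counters as pairs of sequences\<close>

text \<open>Every value of \<open>a\<close> is taken by \<open>b\<close> now or later, and every
  value of \<open>b\<close> was taken by \<open>a\<close> now or before. Growth of \<open>a\<close>
  is left to the transitions; \<open>peak\<close> records it up to the current position.\<close>

definition matched :: "(nat \<Rightarrow> 'd::linorder) \<Rightarrow> (nat \<Rightarrow> 'd) \<Rightarrow> bool" where
  "matched a b \<longleftrightarrow> (\<forall>i. \<exists>j\<ge>i. a i = b j) \<and> (\<forall>i. \<exists>j\<le>i. b i = a j) \<and> (\<forall>i. b i \<le> b (Suc i))"

definition excess :: "(nat \<Rightarrow> 'd::linorder) \<Rightarrow> (nat \<Rightarrow> 'd) \<Rightarrow> nat \<Rightarrow> nat" where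
  "excess a b i = card {v \<in> a ` {..i}. b i < v}"

definition peak :: "(nat \<Rightarrow> 'd::linorder) \<Rightarrow> nat \<Rightarrow> bool" where
  "peak a i \<longleftrightarrow> (\<forall>j\<le>i. a j \<le> a i)"

lemma peak_Suc: "peak a i \<Longrightarrow> a i \<le> a (Suc i) \<Longrightarrow> peak a (Suc i)"
  unfolding peak_def by (metis le_Suc_eq order.refl order.trans)

lemma excess_keep: "a (Suc i) = a i \<Longrightarrow> b (Suc i) = b i \<Longrightarrow> excess a b (Suc i) = excess a b i"
  unfolding excess_def by (auto simp: atMost_Suc intro!: arg_cong[where f = card])

text \<open>By \<open>peak\<close> the new value of \<open>a\<close> differs from all earlier ones,
  and it exceeds \<open>b i\<close>, which is itself an earlier value of \<open>a\<close>.\<close>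

lemma excess_inc:
  assumes "matched a b" "peak a i" "a i < a (Suc i)" "b (Suc i) = b i"
  shows "excess a b (Suc i) = Suc (excess a b i)"
proof -
  have "b i \<le> a i"
    using assms unfolding matched_def peak_def by metis
  then have "{v \<in> a ` {..Suc i}. b (Suc i) < v} = insert (a (Suc i)) {v \<in> a ` {..i}. b i < v}"
    using assms by (auto simp: atMost_Suc)
  moreover have "a (Suc i) \<notin> a ` {..i}"
    using assms unfolding peak_def by (metis atMost_iff image_iff leD)
  ultimately show ?thesis
    unfolding excess_def by simp
qed

text \<open>Any value of \<open>a\<close> above \<open>b i\<close> must still be taken by the
  monotone \<open>b\<close>, hence after \<open>i\<close>, and so is at least
  \<open>b (Suc i)\<close>. Since \<open>b (Suc i)\<close> is itself a value of \<open>a\<close>,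
  exactly this one leaves the set.\<close>

lemma excess_dec:
  assumes m: "matched a b" and a: "a (Suc i) = a i" and b: "b i < b (Suc i)"
  shows "Suc (excess a b (Suc i)) = excess a b i"
proof -
  have mono: "mono b"
    using m unfolding matched_def by (simp add: mono_iff_le_Suc)
  have img: "a ` {..Suc i} = a ` {..i}"
    using a by (auto simp: atMost_Suc)
  have mem: "b (Suc i) \<in> a ` {..i}"
    using m img unfolding matched_def by (metis atMost_iff image_iff)
  have "b (Suc i) \<le> v" if v: "v \<in> a ` {..i}" "b i < v" for v
  proof -
    obtain k where k: "v = b k"
      using m v unfolding matched_def by (metis imageE)
    then have "\<not> k \<le> i"
      using mono v(2) by (metis monoD leD)
    then show ?thesis
      using mono k by (metis monoD not_less_eq_eq)
  qed
  then have "{v \<in> a ` {..i}. b i < v} = insert (b (Suc i)) {v \<in> a ` {..Suc i}. b (Suc i) < v}"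
    using b mem unfolding img
    by (intro set_eqI) (metis (mono_tags, lifting) insert_iff le_less less_trans mem_Collect_eq)
  then show ?thesis
    unfolding excess_def by simp
qed

lemma excess_eq_0:
  assumes "matched a b" "peak a i"
  shows "excess a b i = 0 \<longleftrightarrow> a i = b i"
proof -
  have "b i \<le> a i"
    using assms unfolding matched_def peak_def by metis
  then have "(\<forall>j\<le>i. \<not> b i < a j) \<longleftrightarrow> a i = b i"
    using assms(2) unfolding peak_def by (metis leD le_less order.refl)
  then have "{v \<in> a ` {..i}. b i < v} = {} \<longleftrightarrow> a i = b i"
    by blast
  moreover have "finite {v \<in> a ` {..i}. b i < v}"
    by (rule finite_subset[of _ "a ` {..i}"]) auto
  ultimately show ?thesis
    unfolding excess_def by (metis card_eq_0_iff)
qed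

text \<open>Truncated subtraction makes the two sums count the upward and the downward steps.\<close>

definition ups :: "(nat \<Rightarrow> nat) \<Rightarrow> nat \<Rightarrow> nat" where
  "ups S i = (\<Sum>j<i. S (Suc j) - S j)"

definition downs :: "(nat \<Rightarrow> nat) \<Rightarrow> nat \<Rightarrow> nat" where
  "downs S i = (\<Sum>j<i. S j - S (Suc j))"

text \<open>Vanishing from \<open>N\<close> on lets \<open>downs\<close> catch up with every value
  of \<open>ups\<close>, and it bounds both, so that a finite chain of values is enough.\<close>

definition small_steps :: "nat \<Rightarrow> (nat \<Rightarrow> nat) \<Rightarrow> bool" where
  "small_steps N S \<longleftrightarrow> S 0 = 0 \<and> (\<forall>i\<ge>N. S i = 0) \<and>
     (\<forall>i. S (Suc i) \<le> Suc (S i) \<and> S i \<le> Suc (S (Suc i)))"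

lemma ups_eq: "small_steps N S \<Longrightarrow> ups S i = downs S i + S i"
  unfolding ups_def downs_def small_steps_def by (induction i) auto

lemma ups_le:
  assumes "small_steps N S"
  shows "ups S i \<le> N"
proof -
  \<comment> \<open>The bound by \<open>min i N\<close> is the inductive form: no upward step starts
    at \<open>N\<close> or later.\<close>
  have "ups S i \<le> min i N"
  proof (induction i)
    case (Suc i)
    have "S (Suc i) - S i \<le> (if i < N then 1 else 0)"
      using assms unfolding small_steps_def by (auto simp: le_diff_conv)
    then show ?case
      using Suc by (auto simp: ups_def split: if_splits)
  qed (simp add: ups_def)
  then show ?thesis
    by simp
qed

lemma discrete_ivt:
  fixes f :: "nat \<Rightarrow> nat"
  assumes "\<And>i. f (Suc i) \<le> Suc (f i)" "f m \<le> k" "k \<le> f n" "m \<le> n"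
  shows "\<exists>i\<ge>m. i \<le> n \<and> f i = k"
  using assms(4,3)
proof (induction n rule: dec_induct)
  case base
  then show ?case
    using assms(2) by auto
next
  case (step n)
  then show ?case
    using assms(1)[of n] by (metis le_Suc_eq le_SucI order.trans not_less_eq_eq)
qed

text \<open>Both sums grow by at most one per step. So \<open>downs\<close> meets
  \<open>ups S i\<close> before the final equality of the two, and \<open>ups\<close>, starting from
  0, met \<open>downs S i\<close> before. The monotone \<open>v\<close> carries this over to the
  order.\<close>

lemma matched_ups_downs:
  assumes S: "small_steps N S" and v: "strict_mono_on {..N} v"
  shows "matched (\<lambda>i. v (ups S i)) (\<lambda>i. v (downs S i))"
proof -
  have SN: "\<And>i. i \<ge> N \<Longrightarrow> S i = 0"
    and up: "\<And>i. S (Suc i) \<le> Suc (S i)" and down: "\<And>i. S i \<le> Suc (S (Suc i))"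
    using S unfolding small_steps_def by auto
  note eq = ups_eq[OF S]
  have ups_Suc: "ups S (Suc i) = ups S i + (S (Suc i) - S i)"
    and downs_Suc: "downs S (Suc i) = downs S i + (S i - S (Suc i))" for i
    by (simp_all add: ups_def downs_def)
  have ups_mono: "mono (ups S)"
    by (simp add: mono_iff_le_Suc ups_Suc)
  have "\<exists>j\<ge>i. downs S j = ups S i" for i
  proof -
    let ?n = "max i N"
    have "ups S i \<le> downs S ?n"
      using eq[of ?n] SN[of ?n] monoD[OF ups_mono, of i ?n] by simp
    moreover have "downs S i \<le> ups S i"
      using eq by simp
    moreover have "downs S (Suc i) \<le> Suc (downs S i)" for i
      using down[of i] by (simp add: downs_Suc)
    ultimately show ?thesis
      using discrete_ivt[of "downs S" i "ups S i" ?n] by auto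
  qed
  moreover have "\<exists>j\<le>i. ups S j = downs S i" for i
  proof -
    have "downs S i \<le> ups S i" "ups S 0 \<le> downs S i"
      using eq by (simp_all add: ups_def)
    moreover have "ups S (Suc i) \<le> Suc (ups S i)" for i
      using up[of i] by (simp add: ups_Suc)
    ultimately show ?thesis
      using discrete_ivt[of "ups S" 0 "downs S i" i] by auto
  qed
  moreover have "v (downs S i) \<le> v (downs S (Suc i))" for i
  proof (rule monotone_onD[OF strict_mono_on_imp_mono_on[OF v]])
    show "downs S i \<in> {..N}" "downs S (Suc i) \<in> {..N}"
      using eq[of i] eq[of "Suc i"] ups_le[OF S, of i] ups_le[OF S, of "Suc i"] by auto
  qed (simp add: downs_Suc)
  ultimately show ?thesis
    unfolding matched_def by metis
qed

section \<open>The formula of a machine\<close>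

definition tt :: clrv where
  "tt = LocEqX 0 0 0"

definition Alw :: "clrv \<Rightarrow> clrv" where
  "Alw \<phi> = Not (Until tt (Not \<phi>))"

definition Disj :: "clrv \<Rightarrow> clrv \<Rightarrow> clrv" where
  "Disj \<phi> \<psi> = Not (And (Not \<phi>) (Not \<psi>))"

definition Imp :: "clrv \<Rightarrow> clrv \<Rightarrow> clrv" where
  "Imp \<phi> \<psi> = Not (And \<phi> (Not \<psi>))"

definition Conj :: "clrv list \<Rightarrow> clrv" where
  "Conj \<phi>s = foldr And \<phi>s tt"

lemma holds_tt [simp]: "holds \<sigma> i tt"
  by (simp add: tt_def)

lemma holds_Alw [simp]: "holds \<sigma> i (Alw \<phi>) \<longleftrightarrow> (\<forall>j\<ge>i. holds \<sigma> j \<phi>)"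
  by (auto simp: Alw_def)

lemma holds_Disj [simp]: "holds \<sigma> i (Disj \<phi> \<psi>) \<longleftrightarrow> holds \<sigma> i \<phi> \<or> holds \<sigma> i \<psi>"
  by (simp add: Disj_def)

lemma holds_Imp [simp]: "holds \<sigma> i (Imp \<phi> \<psi>) \<longleftrightarrow> (holds \<sigma> i \<phi> \<longrightarrow> holds \<sigma> i \<psi>)"
  by (simp add: Imp_def)

lemma holds_Conj [simp]: "holds \<sigma> i (Conj \<phi>s) \<longleftrightarrow> (\<forall>\<phi>\<in>set \<phi>s. holds \<sigma> i \<phi>)"
  by (induction \<phi>s) (auto simp: Conj_def)

text \<open>Variables \<open>4 * r\<close> and \<open>4 * r + 1\<close>, local and remote, carry the two sequences of counter \<open>r\<close>.
  The machine is at label \<open>l\<close> iff \<open>4 * l + 2\<close> agrees with the constant variable \<open>3\<close>.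
  Label \<open>0\<close> marks the position at which the counter \<open>0\<close> has been loaded with the input.\<close>

definition lab :: "nat \<Rightarrow> clrv" where
  "lab l = LocEqX (4 * l + 2) 0 3"

definition is_zero :: "nat \<Rightarrow> clrv" where
  "is_zero r = LocEqX (4 * r) 0 (4 * r + 1)"

definition keep :: "nat \<Rightarrow> clrv" where
  "keep r = And (LocEqX (4 * r) 1 (4 * r)) (LocEqX (4 * r + 1) 1 (4 * r + 1))"

definition up :: "nat \<Rightarrow> clrv" where
  "up r = And (LocLtX (4 * r) 1 (4 * r)) (LocEqX (4 * r + 1) 1 (4 * r + 1))"

definition down :: "nat \<Rightarrow> clrv" where
  "down r = And (LocEqX (4 * r) 1 (4 * r)) (LocLtX (4 * r + 1) 1 (4 * r + 1))"

definition only :: "nat \<Rightarrow> nat \<Rightarrow> clrv \<Rightarrow> clrv" where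
  "only R r \<phi> = And \<phi> (Conj (map keep (filter ((\<noteq>) r) [0..<R])))"

fun trans :: "nat \<Rightarrow> instr \<Rightarrow> clrv" where
  "trans R (INC r e) = And (only R r (up r)) (Next (lab e))"
| "trans R (DJZ r l e) =
     And (Imp (is_zero r) (And (only R r (keep r)) (Next (lab e))))
         (Imp (Not (is_zero r)) (And (only R r (down r)) (Next (lab l))))"

text \<open>Order tests exist only for local variables and \<open>XF\<close> only for remote ones,
  so each sequence has both copies. \<open>XF\<close> and its inverse are strict, so the present
  position is a separate disjunct.\<close>

definition counter :: "nat \<Rightarrow> clrv" where
  "counter r = Conj
     [LocEqRem (4 * r) (4 * r), LocEqRem (4 * r + 1) (4 * r + 1),
      Disj (RemEqX (4 * r) 0 (4 * r + 1)) (RemEqXF (4 * r) (4 * r + 1)),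
      Disj (RemEqX (4 * r + 1) 0 (4 * r)) (RemEqXFinv (4 * r + 1) (4 * r)),
      Disj (LocEqX (4 * r + 1) 1 (4 * r + 1)) (LocLtX (4 * r + 1) 1 (4 * r + 1))]"

text \<open>The number of loading steps is left open, which keeps the input out of the formula. As
  \<open>lab 0\<close> holds at one position only, the input atom can fix that number from
  outside.\<close>

definition loading :: "nat \<Rightarrow> clrv" where
  "loading R = Until (And (Not (lab 0)) (only R 0 (up 0)))
     (Conj [lab 0, lab 1, Next (Alw (Not (lab 0)))])"

text \<open>\<open>h\<close> is the exit label, and register \<open>1\<close> holds the result of the program.\<close>

definition machine :: "(nat \<times> instr) list \<Rightarrow> nat \<Rightarrow> nat \<Rightarrow> clrv" where
  "machine T R h = Conj
     ([Alw (LocEqX 3 1 3), loading R, Alw (Imp (lab h) (is_zero 1))]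
      @ map is_zero [0..<R] @ map (\<lambda>r. Alw (counter r)) [0..<R]
      @ map (\<lambda>(l, ins). Alw (Imp (lab l) (trans R ins))) T)"

abbreviation adds :: "(nat \<Rightarrow> var \<Rightarrow> 'd) \<Rightarrow> nat \<Rightarrow> nat \<Rightarrow> 'd" where
  "adds \<sigma> r \<equiv> (\<lambda>i. \<sigma> i (Loc (4 * r)))"

abbreviation subs :: "(nat \<Rightarrow> var \<Rightarrow> 'd) \<Rightarrow> nat \<Rightarrow> nat \<Rightarrow> 'd" where
  "subs \<sigma> r \<equiv> (\<lambda>i. \<sigma> i (Loc (Suc (4 * r))))"

lemma holds_only [simp]:
  "holds \<sigma> i (only R r \<phi>) \<longleftrightarrow> holds \<sigma> i \<phi> \<and> (\<forall>q<R. q \<noteq> r \<longrightarrow> holds \<sigma> i (keep q))"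
  by (auto simp: only_def)

lemma holds_is_zero: "holds \<sigma> i (is_zero r) \<longleftrightarrow> adds \<sigma> r i = subs \<sigma> r i"
  by (simp add: is_zero_def)

lemma holds_keep:
  "holds \<sigma> i (keep r) \<longleftrightarrow> adds \<sigma> r (Suc i) = adds \<sigma> r i \<and> subs \<sigma> r (Suc i) = subs \<sigma> r i"
  by (auto simp: keep_def)

lemma holds_up:
  "holds \<sigma> i (up r) \<longleftrightarrow> adds \<sigma> r i < adds \<sigma> r (Suc i) \<and> subs \<sigma> r (Suc i) = subs \<sigma> r i"
  by (auto simp: up_def)

lemma holds_down:
  "holds \<sigma> i (down r) \<longleftrightarrow> adds \<sigma> r (Suc i) = adds \<sigma> r i \<and> subs \<sigma> r i < subs \<sigma> r (Suc i)"
  by (auto simp: down_def)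

lemma holds_counter:
  "(\<forall>i. holds \<sigma> i (counter r)) \<longleftrightarrow>
     (\<forall>i. \<sigma> i (Rem (4 * r)) = adds \<sigma> r i \<and> \<sigma> i (Rem (Suc (4 * r))) = subs \<sigma> r i) \<and>
     matched (adds \<sigma> r) (subs \<sigma> r)"
proof -
  \<comment> \<open>Splits off the present position, matching the disjunctions in
    \<open>counter\<close>.\<close>
  have 1: "(\<exists>j\<ge>i. P j) \<longleftrightarrow> P i \<or> (\<exists>j>i. P j)" and 2: "(\<exists>j\<le>i. P j) \<longleftrightarrow> P i \<or> (\<exists>j<i. P j)"
    for P :: "nat \<Rightarrow> bool" and i
    by (metis le_eq_less_or_eq)+
  show ?thesis
  proof (cases "\<forall>i. \<sigma> i (Rem (4 * r)) = adds \<sigma> r i \<and> \<sigma> i (Rem (Suc (4 * r))) = subs \<sigma> r i")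
    case True
    then show ?thesis
      unfolding matched_def 1 2 by (simp add: counter_def le_less) blast
  next
    case False
    then show ?thesis
      by (auto simp: counter_def)
  qed
qed

lemma holds_machine:
  "holds \<sigma> 0 (machine T R h) \<longleftrightarrow>
     (\<forall>i. \<sigma> i (Loc 3) = \<sigma> (Suc i) (Loc 3)) \<and> holds \<sigma> 0 (loading R) \<and>
     (\<forall>i. holds \<sigma> i (lab h) \<longrightarrow> holds \<sigma> i (is_zero 1)) \<and>
     (\<forall>r<R. holds \<sigma> 0 (is_zero r) \<and> (\<forall>i. holds \<sigma> i (counter r))) \<and>
     (\<forall>(l, ins)\<in>set T. \<forall>i. holds \<sigma> i (Imp (lab l) (trans R ins)))"
  by (simp add: machine_def ball_Un atLeast0LessThan lessThan_def case_prod_unfold) blast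

section \<open>Soundness: every model follows the run\<close>

definition tracks :: "(nat \<Rightarrow> var \<Rightarrow> 'd::linorder) \<Rightarrow> nat \<Rightarrow> nat \<Rightarrow> (nat \<Rightarrow> nat) \<Rightarrow> bool" where
  "tracks \<sigma> R i s \<longleftrightarrow> (\<forall>r<R. peak (adds \<sigma> r) i \<and> excess (adds \<sigma> r) (subs \<sigma> r) i = s r)"

lemma tracks_keep:
  assumes "peak (adds \<sigma> q) i" "holds \<sigma> i (keep q)"
  shows "peak (adds \<sigma> q) (Suc i)"
    "excess (adds \<sigma> q) (subs \<sigma> q) (Suc i) = excess (adds \<sigma> q) (subs \<sigma> q) i"
  using assms peak_Suc[of "adds \<sigma> q" i] excess_keep[of "adds \<sigma> q" i "subs \<sigma> q"]
  unfolding holds_keep by simp_all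

lemma tracks_up:
  assumes "tracks \<sigma> R i s" "\<forall>r<R. matched (adds \<sigma> r) (subs \<sigma> r)" "holds \<sigma> i (only R r (up r))"
  shows "tracks \<sigma> R (Suc i) (s(r := Suc (s r)))"
  unfolding tracks_def
proof (intro allI impI)
  fix q
  assume q: "q < R"
  then have q': "peak (adds \<sigma> q) i" "excess (adds \<sigma> q) (subs \<sigma> q) i = s q"
    using assms(1) unfolding tracks_def by auto
  show "peak (adds \<sigma> q) (Suc i) \<and> excess (adds \<sigma> q) (subs \<sigma> q) (Suc i) = (s(r := Suc (s r))) q"
  proof (cases "q = r")
    case True
    then show ?thesis
      using assms q q' peak_Suc[of "adds \<sigma> q" i] excess_inc[of "adds \<sigma> q" "subs \<sigma> q" i]
      by (simp add: holds_up less_imp_le)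
  next
    case False
    then show ?thesis
      using assms(3) q q' tracks_keep[of \<sigma> q i] by simp
  qed
qed

lemma tracks_down:
  assumes "tracks \<sigma> R i s" "\<forall>r<R. matched (adds \<sigma> r) (subs \<sigma> r)" "holds \<sigma> i (only R r (down r))"
  shows "tracks \<sigma> R (Suc i) (s(r := s r - 1))"
  unfolding tracks_def
proof (intro allI impI)
  fix q
  assume q: "q < R"
  then have q': "peak (adds \<sigma> q) i" "excess (adds \<sigma> q) (subs \<sigma> q) i = s q"
    using assms(1) unfolding tracks_def by auto
  show "peak (adds \<sigma> q) (Suc i) \<and> excess (adds \<sigma> q) (subs \<sigma> q) (Suc i) = (s(r := s r - 1)) q"
  proof (cases "q = r")
    case True
    then show ?thesis
      using assms q q' peak_Suc[of "adds \<sigma> q" i] excess_dec[of "adds \<sigma> q" "subs \<sigma> q" i]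
      by (simp add: holds_down)
  next
    case False
    then show ?thesis
      using assms(3) q q' tracks_keep[of \<sigma> q i] by simp
  qed
qed

lemma tracks_zero:
  assumes "tracks \<sigma> R i s" "\<forall>r<R. matched (adds \<sigma> r) (subs \<sigma> r)" "r < R"
  shows "holds \<sigma> i (is_zero r) \<longleftrightarrow> s r = 0"
  using assms excess_eq_0[of "adds \<sigma> r" "subs \<sigma> r" i] unfolding tracks_def holds_is_zero by auto

fun reg :: "instr \<Rightarrow> nat" where
  "reg (INC r e) = r"
| "reg (DJZ r l e) = r"

text \<open>Several labels may hold at one position. It suffices that the label of the run is among
  them, since its transition is then enforced.\<close>

lemma tracks_step:
  assumes "step T c c'" "\<forall>(l, ins)\<in>set T. reg ins < R"
    "\<forall>(l, ins)\<in>set T. holds \<sigma> i (Imp (lab l) (trans R ins))"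
    "\<forall>r<R. matched (adds \<sigma> r) (subs \<sigma> r)"
    "holds \<sigma> i (lab (fst c))" "tracks \<sigma> R i (snd c)"
  shows "holds \<sigma> (Suc i) (lab (fst c')) \<and> tracks \<sigma> R (Suc i) (snd c')"
  using assms(1)
proof cases
  case (INC l r e s)
  then have "holds \<sigma> i (trans R (INC r e))"
    using assms by auto
  then show ?thesis
    using INC assms tracks_up[of \<sigma> R i s r] by simp
next
  case (DJZ_0 l r l' e s)
  then have "holds \<sigma> i (trans R (DJZ r l' e))" "holds \<sigma> i (is_zero r)"
    using assms tracks_zero[of \<sigma> R i s r] by auto
  then have "holds \<sigma> (Suc i) (lab e)" "\<forall>q<R. holds \<sigma> i (keep q)"
    by auto
  then show ?thesis
    using DJZ_0 assms(6) tracks_keep[of \<sigma> _ i] unfolding tracks_def by simp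
next
  case (DJZ_S l r l' e s)
  then have "holds \<sigma> i (trans R (DJZ r l' e))" "\<not> holds \<sigma> i (is_zero r)"
    using assms tracks_zero[of \<sigma> R i s r] by auto
  then show ?thesis
    using DJZ_S assms tracks_down[of \<sigma> R i s r] by simp
qed

text \<open>The model carries the run along up to the exit label, where the formula demands that the
  result register be zero.\<close>

lemma machine_sound:
  assumes mach: "holds \<sigma> 0 (machine T R h)" and inp: "\<sigma> 0 (Loc 3) = \<sigma> n (Loc 2)"
    and R: "1 < R" "\<forall>(l, ins)\<in>set T. reg ins < R"
    and steps: "(step T)\<^sup>*\<^sup>* (1, (\<lambda>_. 0)(0 := n)) (h, s)"
  shows "s 1 = 0"
proof -
  have const: "\<sigma> i (Loc 3) = \<sigma> 0 (Loc 3)" for i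
    using mach by (induction i) (auto simp: holds_machine)
  have start: "holds \<sigma> i (lab 0) \<longleftrightarrow> \<sigma> i (Loc 2) = \<sigma> 0 (Loc 3)" for i
    using const[of i] by (simp add: lab_def numeral_2_eq_2)
  have m: "\<forall>r<R. matched (adds \<sigma> r) (subs \<sigma> r)"
  proof (intro allI impI)
    fix r
    assume "r < R"
    then have "\<forall>i. holds \<sigma> i (counter r)"
      using mach unfolding holds_machine by blast
    then show "matched (adds \<sigma> r) (subs \<sigma> r)"
      unfolding holds_counter by blast
  qed
  have rules: "\<forall>(l, ins)\<in>set T. holds \<sigma> i (Imp (lab l) (trans R ins))" for i
    using mach unfolding holds_machine by auto
  obtain k where k: "holds \<sigma> k (lab 0)" "holds \<sigma> k (lab 1)" "\<forall>j\<ge>Suc k. \<not> holds \<sigma> j (lab 0)"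
    and load: "\<forall>j<k. \<not> holds \<sigma> j (lab 0) \<and> holds \<sigma> j (only R 0 (up 0))"
    using mach unfolding holds_machine loading_def by auto
  have n: "holds \<sigma> n (lab 0)"
    using inp by (simp add: start)
  \<comment> \<open>\<open>lab 0\<close> is excluded before \<open>k\<close> by the loading phase
    and after \<open>k\<close> by its final condition.\<close>
  then have "k = n"
    using k(3) load by (meson linorder_neqE_nat not_less_eq_eq Suc_leI)
  have tracks_0: "tracks \<sigma> R 0 (\<lambda>_. 0)"
    using mach by (auto simp: tracks_def peak_def excess_def holds_machine holds_is_zero)
  have "tracks \<sigma> R j ((\<lambda>_. 0)(0 := j))" if "j \<le> k" for j
    using that
  proof (induction j)
    case 0
    then show ?case
      using tracks_0 by (simp add: fun_upd_idem)
  next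
    case (Suc j)
    then have "holds \<sigma> j (only R 0 (up 0))"
      using load by simp
    from tracks_up[OF Suc.IH[OF Suc_leD[OF Suc.prems]] m this] show ?case
      by (simp only: fun_upd_same fun_upd_upd)
  qed
  then have init: "holds \<sigma> n (lab 1)" "tracks \<sigma> R n ((\<lambda>_. 0)(0 := n))"
    using k \<open>k = n\<close> by auto
  have "\<exists>i. holds \<sigma> i (lab (fst c)) \<and> tracks \<sigma> R i (snd c)"
    if "(step T)\<^sup>*\<^sup>* (1, (\<lambda>_. 0)(0 := n)) c" for c
    using that
  proof induction
    case base
    then show ?case
      using init by (auto simp del: fun_upd_apply)
  next
    case (step c c')
    then show ?case
      using tracks_step[OF _ R(2) rules m] by blast
  qed
  from this[OF steps] obtain i where i: "holds \<sigma> i (lab h)" "tracks \<sigma> R i s"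
    by auto
  then have "holds \<sigma> i (is_zero 1)"
    using mach unfolding holds_machine by blast
  then show ?thesis
    using tracks_zero[OF i(2) m R(1)] by simp
qed

section \<open>Completeness: a halting run with result zero yields a model\<close>

lemma exists_chain:
  assumes "infinite (UNIV :: 'd::linorder set)"
  shows "\<exists>v :: nat \<Rightarrow> 'd. strict_mono_on {..N} v"
proof -
  \<comment> \<open>An infinite total order may lack an infinite ascending sequence, but a finite
    subset of any size can be listed in increasing order.\<close>
  obtain X :: "'d set" where X: "finite X" "card X = Suc N"
    using infinite_arbitrarily_large[OF assms] by blast
  have "strict_mono_on {..N} ((!) (sorted_list_of_set X))"
    using X by (intro strict_mono_onI sorted_wrt_nth_less[OF strict_sorted_list_of_set]) auto
  then show ?thesis
    by (rule exI[of "strict_mono_on {..N}"])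
qed

lemma step_small:
  assumes "step T c c'"
  shows "snd c' r \<le> Suc (snd c r) \<and> snd c r \<le> Suc (snd c' r)"
  using assms by cases auto

text \<open>The run must end with all registers zero: \<open>matched\<close> requires every value
  added to a counter to be removed again.\<close>

lemma machine_complete:
  assumes inf: "infinite (UNIV :: 'd::linorder set)"
    and T: "distinct (map fst T)" "0 \<notin> fst ` set T" "h \<notin> fst ` set T" "h \<noteq> 0"
    and steps: "(step T)\<^sup>*\<^sup>* (1, (\<lambda>_. 0)(0 := n)) (h, \<lambda>_. 0)"
  shows "\<exists>\<sigma> :: nat \<Rightarrow> var \<Rightarrow> 'd. holds \<sigma> 0 (machine T R h) \<and> \<sigma> 0 (Loc 3) = \<sigma> n (Loc 2)"
proof -
  from steps obtain N where "((step T) ^^ N) (1, (\<lambda>_. 0)(0 := n)) (h, \<lambda>_. 0)"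
    by (auto dest: rtranclp_imp_relpowp)
  then obtain run where run: "run 0 = (1, (\<lambda>_. 0)(0 := n))" "run N = (h, \<lambda>_. 0)"
    "\<forall>i<N. step T (run i) (run (Suc i))"
    unfolding relpowp_fun_conv by blast
  \<comment> \<open>The run is delayed by the \<open>n\<close> loading steps and frozen in its last
    configuration; \<open>S r\<close> is the resulting history of counter \<open>r\<close>.\<close>
  define cfg where "cfg i = run (min (i - n) N)" for i
  define S where "S r i = (if i < n then ((\<lambda>_. 0)(0 := i)) r else snd (cfg i) r)" for r i
  have cfg_n: "cfg n = (1, (\<lambda>_. 0)(0 := n))"
    by (simp add: cfg_def run)
  have cfg_step: "i < n + N \<and> step T (cfg i) (cfg (Suc i)) \<or> cfg i = (h, \<lambda>_. 0) \<and> cfg (Suc i) = cfg i"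
    if "n \<le> i" for i
  proof (cases "i < n + N")
    case True
    then have "i - n < N" "min (i - n) N = i - n" "min (Suc i - n) N = Suc (i - n)"
      using that by auto
    then show ?thesis
      using True run(3) by (simp add: cfg_def)
  next
    case False
    then have "min (i - n) N = N" "min (Suc i - n) N = N"
      by auto
    then show ?thesis
      using run(2) by (simp add: cfg_def)
  qed
  have S_load: "S r (Suc i) = (if r = 0 then Suc (S r i) else S r i)" if "i < n" for r i
    using that cfg_n by (cases "Suc i = n") (auto simp: S_def)
  have S_run: "S r i = snd (cfg i) r" if "n \<le> i" for r i
    using that by (simp add: S_def)
  have small: "small_steps (n + N) (S r)" for r
  proof -
    have "S r 0 = 0"
      using cfg_n by (cases "n = 0") (auto simp: S_def)
    moreover have "S r i = 0" if "n + N \<le> i" for i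
    proof -
      have "min (i - n) N = N"
        using that by auto
      then show ?thesis
        using that run(2) by (simp add: S_run cfg_def)
    qed
    moreover have "S r (Suc i) \<le> Suc (S r i) \<and> S r i \<le> Suc (S r (Suc i))" for i
    proof (cases "i < n")
      case True
      then show ?thesis
        using S_load by auto
    next
      case False
      then show ?thesis
        using cfg_step[of i] step_small[of T "cfg i" "cfg (Suc i)" r] by (auto simp: S_run)
    qed
    ultimately show ?thesis
      unfolding small_steps_def by blast
  qed
  \<comment> \<open>One more than the counters use, so that \<open>v 0\<close> and
    \<open>v 1\<close> are distinct even if \<open>n + N = 0\<close>.\<close>
  let ?M = "Suc (n + N)"
  obtain v :: "nat \<Rightarrow> 'd" where v: "strict_mono_on {..?M} v"
    using exists_chain[OF inf] by blast
  have v': "strict_mono_on {..n + N} v"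
    using v by (rule monotone_on_subset) auto
  have v_eq: "v p = v q \<longleftrightarrow> p = q" if "p \<le> ?M" "q \<le> ?M" for p q
    using strict_mono_on_imp_inj_on[OF v] that by (auto dest: inj_onD)
  have v_less: "v p < v q" if "p < q" "q \<le> ?M" for p q
    using strict_mono_onD[OF v, of p q] that by auto
  define at where "at i l \<longleftrightarrow> (if l = 0 then i = n else n \<le> i \<and> l = fst (cfg i))" for i l
  \<comment> \<open>Residue 3 is constantly \<open>v 0\<close>, and a label variable (residue 2)
    takes this value exactly where its label holds.\<close>
  define m where "m i k = (if k mod 4 = 0 then v (ups (S (k div 4)) i)
      else if k mod 4 = 1 then v (downs (S (k div 4)) i)
      else if k mod 4 = 2 \<and> \<not> at i (k div 4) then v 1 else v 0)" for i k :: nat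
  define \<sigma> where "\<sigma> i x = (case x of Loc k \<Rightarrow> m i k | Rem k \<Rightarrow> m i k)" for i x
  have m_adds: "m i (4 * r) = v (ups (S r) i)" for i r
    by (simp add: m_def)
  have m_subs: "m i (Suc (4 * r)) = v (downs (S r) i)" for i r
  proof -
    have "Suc (4 * r) mod 4 = 1" "Suc (4 * r) div 4 = r"
      by presburger+
    then show ?thesis
      by (simp add: m_def)
  qed
  have m_ref: "m i 3 = v 0" for i
    by (simp add: m_def)
  have lab: "holds \<sigma> i (lab l) \<longleftrightarrow> at i l" for i l
  proof -
    have "Suc (Suc (4 * l)) mod 4 = 2" "Suc (Suc (4 * l)) div 4 = l"
      by presburger+
    then show ?thesis
      using v_eq[of 0 1] m_ref by (simp add: lab_def \<sigma>_def m_def)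
  qed
  have le: "ups (S r) i \<le> n + N" "downs (S r) i \<le> n + N" for r i
    using ups_le[OF small] ups_eq[OF small] by (metis, metis le_add1 order.trans)
  have ups_Suc: "ups (S r) (Suc i) = ups (S r) i + (S r (Suc i) - S r i)"
    and downs_Suc: "downs (S r) (Suc i) = downs (S r) i + (S r i - S r (Suc i))" for r i
    by (simp_all add: ups_def downs_def)
  have zero: "holds \<sigma> i (is_zero r) \<longleftrightarrow> S r i = 0" for i r
    using v_eq[of "ups (S r) i" "downs (S r) i"] le[of r i] ups_eq[OF small, of r i]
    by (simp add: holds_is_zero \<sigma>_def m_adds m_subs)
  have keep: "holds \<sigma> i (keep r)" if "S r (Suc i) = S r i" for i r
    using that by (simp add: holds_keep \<sigma>_def m_adds m_subs ups_Suc downs_Suc)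
  have up: "holds \<sigma> i (up r)" if "S r (Suc i) = Suc (S r i)" for i r
    using that v_less[of "ups (S r) i" "ups (S r) (Suc i)"] le[of r "Suc i"]
    by (simp add: holds_up \<sigma>_def m_adds m_subs ups_Suc downs_Suc)
  have down: "holds \<sigma> i (down r)" if "S r i = Suc (S r (Suc i))" for i r
    using that v_less[of "downs (S r) i" "downs (S r) (Suc i)"] le[of r "Suc i"]
    by (simp add: holds_down \<sigma>_def m_adds m_subs ups_Suc downs_Suc)
  have counter: "holds \<sigma> i (counter r)" for i r
    using holds_counter[of \<sigma> r] matched_ups_downs[OF small v'] by (simp add: \<sigma>_def m_adds m_subs)
  have rule: "holds \<sigma> i (trans R ins)" if ins: "(l, ins) \<in> set T" and l: "at i l" for i l ins
  proof -
    have l0: "l \<noteq> 0" "l \<noteq> h"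
      using T ins by force+
    then have i: "n \<le> i" "l = fst (cfg i)"
      using l by (auto simp: at_def)
    have uniq: "ins' = ins" if "(l, ins') \<in> set T" for ins'
      using T(1) ins that by (metis eq_key_imp_eq_value)
    \<comment> \<open>Label 0 is reserved by \<open>at\<close> for the end of loading, so the
      successor label must differ from it. It either has an instruction or is
      \<open>h\<close>.\<close>
    have nz: "fst (cfg (Suc i)) \<noteq> 0"
    proof -
      have "(\<exists>c. step T (cfg (Suc i)) c) \<or> fst (cfg (Suc i)) = h"
        using cfg_step[of "Suc i"] i by (metis fst_conv le_SucI)
      then show ?thesis
        using T by (auto elim!: step.cases) force+
    qed
    then have next_lab: "holds \<sigma> (Suc i) (lab (fst (cfg (Suc i))))"
      using i by (simp add: lab at_def)
    have S: "S r i = snd (cfg i) r" "S r (Suc i) = snd (cfg (Suc i)) r" for r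
      using i by (simp_all add: S_run)
    have "step T (cfg i) (cfg (Suc i))"
      using cfg_step[OF i(1)] i(2) l0 by auto
    then show ?thesis
    proof cases
      case (INC l' r e s)
      then have "ins = INC r e"
        using uniq i by auto
      then show ?thesis
        using INC next_lab up keep S by simp
    next
      case (DJZ_0 l' r j e s)
      then have "ins = DJZ r j e"
        using uniq i by auto
      then show ?thesis
        using DJZ_0 next_lab zero keep S by simp
    next
      case (DJZ_S l' r j e s)
      then have "ins = DJZ r j e"
        using uniq i by auto
      then show ?thesis
        using DJZ_S next_lab zero down keep S by simp
    qed
  qed
  have exit: "holds \<sigma> i (is_zero 1)" if "at i h" for i
  proof -
    have i: "n \<le> i" "fst (cfg i) = h"
      using that T(4) by (auto simp: at_def)
    then have "\<not> step T (cfg i) c" for c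
      using T(3) by (auto elim!: step.cases) force+
    then have "cfg i = (h, \<lambda>_. 0)"
      using cfg_step[OF i(1)] by auto
    then show ?thesis
      using i by (simp add: zero S_run)
  qed
  have init: "holds \<sigma> 0 (is_zero r)" for r
    using small[of r] by (simp add: zero small_steps_def)
  have ref: "\<sigma> i (Loc 3) = \<sigma> (Suc i) (Loc 3)" for i
    by (simp add: \<sigma>_def m_ref)
  have load: "holds \<sigma> 0 (loading R)"
    unfolding loading_def using S_load up keep by (auto simp: lab at_def cfg_n intro!: exI[of _ n])
  have "holds \<sigma> 0 (machine T R h)"
    unfolding holds_machine holds_Imp lab using ref load exit init counter rule by blast
  moreover have "\<sigma> 0 (Loc 3) = \<sigma> n (Loc 2)"
    using m_ref by (simp add: \<sigma>_def m_def at_def)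
  ultimately show ?thesis
    by blast
qed

section \<open>Diagonalization\<close>

definition r_add :: recf where
  "r_add = PrimRec (Proj 0) (Comp Succ [Proj 1])"

definition r_triangle :: recf where
  "r_triangle = PrimRec Zero (Comp r_add [Comp Succ [Proj 0], Proj 1])"

text \<open>Cantor pairing: \<open>prod_encode (m, n) = triangle (m + n) + m\<close>.\<close>

definition r_pair :: "recf \<Rightarrow> recf \<Rightarrow> recf" where
  "r_pair f g = Comp r_add [Comp r_triangle [Comp r_add [f, g]], f]"

fun r_const :: "nat \<Rightarrow> recf" where
  "r_const 0 = Zero"
| "r_const (Suc k) = Comp Succ [r_const k]"

lemma reval_Comp1: "reval g xs y \<Longrightarrow> reval f [y] z \<Longrightarrow> reval (Comp f [g]) xs z"
  by (rule reval.comp[of "[y]"]) auto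

lemma reval_Comp2:
  "reval g xs y \<Longrightarrow> reval h xs y' \<Longrightarrow> reval f [y, y'] z \<Longrightarrow> reval (Comp f [g, h]) xs z"
  by (rule reval.comp[of "[y, y']"]) (auto simp: less_Suc_eq)

lemma reval_Proj: "i < length xs \<Longrightarrow> xs ! i = y \<Longrightarrow> reval (Proj i) xs y"
  using reval.proj by blast

lemma reval_add: "reval r_add [m, n] (m + n)"
  unfolding r_add_def
proof (induction m)
  case 0
  show ?case
    unfolding add_0 by (rule reval.pr0[OF reval_Proj]) auto
next
  case (Suc m)
  have "reval (Comp Succ [Proj 1]) [m, m + n, n] (Suc (m + n))"
    by (rule reval_Comp1[OF reval_Proj reval.succ]) auto
  then show ?case
    using reval.prS[OF Suc] by simp
qed

lemma reval_triangle: "reval r_triangle [n] (triangle n)"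
  unfolding r_triangle_def
proof (induction n)
  case 0
  show ?case
    by (auto intro: reval.pr0 reval.zero)
next
  case (Suc n)
  have "reval (Comp r_add [Comp Succ [Proj 0], Proj 1]) [n, triangle n] (Suc n + triangle n)"
    by (rule reval_Comp2[OF reval_Comp1[OF reval_Proj reval.succ] reval_Proj reval_add]) auto
  then show ?case
    using reval.prS[OF Suc] by (simp add: add.commute)
qed

lemma reval_pair:
  assumes "reval f xs m" "reval g xs n"
  shows "reval (r_pair f g) xs (prod_encode (m, n))"
  unfolding r_pair_def prod_encode_def prod.case
  by (rule reval_Comp2[OF reval_Comp1[OF reval_Comp2[OF assms reval_add] reval_triangle]
        assms(1) reval_add])

lemma reval_const: "reval (r_const k) xs k"
  by (induction k) (auto intro: reval.zero reval_Comp1 reval.succ)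

text \<open>Maps the code of \<open>\<psi>\<close> to the code of \<open>\<psi>\<close> together with the input condition that this very
  code is loaded into counter \<open>0\<close>.\<close>

definition r_diag :: recf where
  "r_diag = r_pair (r_const 6) (r_pair (Proj 0)
     (r_pair (r_const 0) (r_pair (r_const 3) (r_pair (Proj 0) (r_const 2)))))"

text \<open>In \<open>r_diag\<close>, 6 and 0 are the tags of \<open>And\<close> and
  \<open>LocEqX\<close>, and 3 and 2 the variables of the input atom. The argument enters twice, as
  a subformula code and as the offset.\<close>

lemma reval_diag: "reval r_diag [encode \<psi>] (encode (And \<psi> (LocEqX 3 (encode \<psi>) 2)))"
  unfolding r_diag_def encode.simps tag_def
  by (intro reval_pair reval_const reval_Proj) auto

theorem theorem3p2p1:
  assumes "infinite (UNIV :: 'd::linorder set)"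
  shows "\<not> decidable_via encode (satisfiable TYPE('d))"
proof
  let ?sat = "satisfiable TYPE('d)"
  assume "decidable_via encode ?sat"
  then obtain f where f: "\<And>\<phi>. reval f [encode \<phi>] (if ?sat \<phi> then 1 else 0)"
    unfolding decidable_via_def by blast
  \<comment> \<open>Input in register 0, result in 1, scratch from 2 on. The final loop erases the
    input, so that result 0 leaves all registers zero, as completeness requires.\<close>
  define c where "c = Seq (compile (Comp f [r_diag]) [0] 1 2) (Loop 0 (Dec 0))"
  define h where "h = 1 + len c"
  define T where "T = code 1 h c"
  have fst_T: "map fst T = [1..<h]"
    unfolding T_def h_def by (rule map_fst_code)
  then have "fst ` set T = {1..<h}"
    by (metis set_map set_upt)
  then have T: "distinct (map fst T)" "0 \<notin> fst ` set T" "h \<notin> fst ` set T" "h \<noteq> 0"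
    using fst_T by (simp_all add: h_def)
  \<comment> \<open>The sum bounds every register in \<open>T\<close>; the two successors make the
    bound strict and include register 1.\<close>
  define R where "R = Suc (Suc (\<Sum>(l, ins)\<leftarrow>T. reg ins))"
  have R: "1 < R" "\<forall>(l, ins)\<in>set T. reg ins < R"
    using member_le_sum_list[of _ "map (\<lambda>(l, ins). reg ins) T"]
    by (force simp: R_def less_Suc_eq_le le_SucI)+
  define \<psi> where "\<psi> = machine T R h"
  \<comment> \<open>No circularity arises: \<open>\<psi>\<close> is built from the program alone and
    does not mention \<open>n\<close>.\<close>
  define n where "n = encode \<psi>"
  define \<phi> where "\<phi> = And \<psi> (LocEqX 3 n 2)"
  define y :: nat where "y = (if ?sat \<phi> then 1 else 0)"
  have sat: "?sat \<phi> \<longleftrightarrow> (\<exists>\<sigma> :: nat \<Rightarrow> var \<Rightarrow> 'd. holds \<sigma> 0 (machine T R h) \<and> \<sigma> 0 (Loc 3) = \<sigma> n (Loc 2))"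
    by (simp add: satisfiable_def \<phi>_def \<psi>_def)
  have "reval (Comp f [r_diag]) [n] y"
    unfolding y_def using reval_Comp1[OF reval_diag f] by (simp add: n_def \<phi>_def)
  then have "exec (compile (Comp f [r_diag]) [0] 1 2) ((\<lambda>_. 0)(0 := n)) ((\<lambda>_. 0)(0 := n, 1 := y))"
    by (intro computesD[OF computes]) auto
  then have "exec c ((\<lambda>_. 0)(0 := n)) ((\<lambda>_. 0)(0 := n, 1 := y, 0 := 0))"
    unfolding c_def by (rule exec.seq[OF _ exec_clear])
  then have "exec c ((\<lambda>_. 0)(0 := n)) ((\<lambda>_. 0)(1 := y))"
    by (rule exec_eq) (auto simp: fun_eq_iff)
  then have steps: "(step T)\<^sup>*\<^sup>* (1, (\<lambda>_. 0)(0 := n)) (h, (\<lambda>_. 0)(1 := y))"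
    by (rule exec_steps) (simp add: T_def)
  show False
  proof (cases "?sat \<phi>")
    case True
    then have "((\<lambda>_. 0)(1 := y)) (1::nat) = (0::nat)"
      using machine_sound[OF _ _ R steps] sat by blast
    then show False
      using True by (simp add: y_def)
  next
    case False
    then have "((\<lambda>_. 0)(1 := y)) = (\<lambda>_::nat. 0::nat)"
      by (auto simp: y_def)
    then show False
      using machine_complete[OF assms T] steps sat False by metis
  qed
qed

end
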